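(* Let $\varphi$ be a non-elliptic automorphism of $\mathbb{D}$ and let $\{z_k\}_{k\ge1}$ be a Blaschke sequence contained in the fundamental domain $D_\varphi$. Then: (1) if $\varphi$ is hyperbolic, $\{\varphi^{(n)}(z_k): k\ge1,\ n\in\mathbb{Z}\}$ is always a Blaschke sequence; (2) if $\varphi$ is parabolic, $\{\varphi^{(n)}(z_k): k\ge1,\ n\in\mathbb{Z}\}$ is a Blaschke sequence if and only if $\{z_k\}$ stays outside of some horocycle tangent to $\partial\mathbb{D}$ at the fixed point of $\varphi$.
   Context: $\mathbb{D}$ is the open unit disc in $\mathbb{C}$. An automorphism $\varphi$ of $\mathbb{D}$ is non-elliptic if it is hyperbolic (it fixes exactly two points, both on $\partial\mathbb{D}$) or parabolic (it fixes exactly one point, located on $\partial\mathbb{D}$); in particular it is not the identity. For $n\in\mathbb{Z}$, $\varphi^{(n)}$ is the $|n|$-th iterate of $\varphi$ if $n>0$, of $\varphi^{-1}$ if $n<0$, and the identity if $n=0$. A family $\{w_i\}_{i\in I}$ of points of $\mathbb{D}$ (indexed, with repetitions counted) is a Blaschke sequence if $\sum_{i\in I}(1-|w_i|)<\infty$; in (1) and (2) the index set is $\{(k,n):k\ge1,\ n\in\mathbb{Z}\}$. The fundamental domain $D_\varphi\subset\mathbb{D}$ contains exactly one point of each bilateral orbit $\{\varphi^{(n)}(z):n\in\mathbb{Z}\}$, $z\in\mathbb{D}$, and is chosen as follows. Let $\mathbb{C}_+=\{v\in\mathbb{C}:\operatorname{Im} v>0\}$. If $\varphi$ is hyperbolic,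 fix a conformal map $h$ from $\mathbb{D}$ onto $\mathbb{C}_+$ such that $h\circ\varphi\circ h^{-1}(w)=\alpha w$ with $\alpha>1$, and put $D_\varphi=\{z\in\mathbb{D}: 1\le|h(z)|<\alpha\}$. If $\varphi$ is parabolic, fix a conformal map $h$ from $\mathbb{D}$ onto $\mathbb{C}_+$ such that $h\circ\varphi\circ h^{-1}(w)=w+t$ with $t\in\mathbb{R}\setminus\{0\}$, and put $D_\varphi=\{z\in\mathbb{D}: 0\le\operatorname{Re}h(z)<|t|\}$. A horocycle tangent to $\partial\mathbb{D}$ at $\xi\in\partial\mathbb{D}$ is a Euclidean circle of radius less than $1$ in $\overline{\mathbb{D}}$ internally tangent to $\partial\mathbb{D}$ at $\xi$; the sequence stays outside of it if no $z_k$ lies in the open disc it bounds. *)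

theory Defs
  imports "HOL-Complex_Analysis.Complex_Analysis"
begin

abbreviation unit_disc :: "complex set" where
  "unit_disc \<equiv> ball 0 1"

definition upper_half_plane :: "complex set" where
  "upper_half_plane = {v. Im v > 0}"

definition conformal_map :: "(complex \<Rightarrow> complex) \<Rightarrow> complex set \<Rightarrow> complex set \<Rightarrow> bool" where
  "conformal_map f U V \<longleftrightarrow> f holomorphic_on U \<and> bij_betw f U V"

text \<open>Maps of the disc are total functions on the complex plane; their values outside the open disc
  carry no information and are never used.\<close>

definition disc_automorphism :: "(complex \<Rightarrow> complex) \<Rightarrow> bool" where
  "disc_automorphism \<phi> \<longleftrightarrow> conformal_map \<phi> unit_disc unit_disc"

text \<open>Fixed points in the closed disc. An automorphism extends continuously to the unit circle, and
  a point of the circle is fixed if the extension fixes it; the extension is expressed by the limit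
  from inside the disc.\<close>

definition disc_fixed_points :: "(complex \<Rightarrow> complex) \<Rightarrow> complex set" where
  "disc_fixed_points \<phi> =
     {z \<in> unit_disc. \<phi> z = z} \<union>
     {\<xi> \<in> sphere 0 1. (\<phi> \<longlongrightarrow> \<xi>) (at \<xi> within unit_disc)}"

definition hyperbolic_automorphism :: "(complex \<Rightarrow> complex) \<Rightarrow> bool" where
  "hyperbolic_automorphism \<phi> \<longleftrightarrow>
     disc_automorphism \<phi> \<and> card (disc_fixed_points \<phi>) = 2 \<and> disc_fixed_points \<phi> \<subseteq> sphere 0 1"

definition parabolic_automorphism :: "(complex \<Rightarrow> complex) \<Rightarrow> bool" where
  "parabolic_automorphism \<phi> \<longleftrightarrow>
     disc_automorphism \<phi> \<and> card (disc_fixed_points \<phi>) = 1 \<and> disc_fixed_points \<phi> \<subseteq> sphere 0 1"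

definition non_elliptic_automorphism :: "(complex \<Rightarrow> complex) \<Rightarrow> bool" where
  "non_elliptic_automorphism \<phi> \<longleftrightarrow> hyperbolic_automorphism \<phi> \<or> parabolic_automorphism \<phi>"

definition disc_iterate :: "(complex \<Rightarrow> complex) \<Rightarrow> int \<Rightarrow> complex \<Rightarrow> complex" where
  "disc_iterate \<phi> n =
     (if n \<ge> 0 then \<phi> ^^ nat n else inv_into unit_disc \<phi> ^^ nat (- n))"

definition blaschke_sequence :: "'i set \<Rightarrow> ('i \<Rightarrow> complex) \<Rightarrow> bool" where
  "blaschke_sequence I w \<longleftrightarrow>
     (\<forall>i\<in>I. w i \<in> unit_disc) \<and> (\<lambda>i. 1 - cmod (w i)) summable_on I"

text \<open>The fundamental domain depends on the choice of the linearizing map \<open>h\<close>, so being one is a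
  predicate on sets rather than a function of the automorphism.\<close>

definition fundamental_domain :: "(complex \<Rightarrow> complex) \<Rightarrow> complex set \<Rightarrow> bool" where
  "fundamental_domain \<phi> D \<longleftrightarrow>
     (hyperbolic_automorphism \<phi> \<and>
       (\<exists>h. \<exists>\<alpha>::real. conformal_map h unit_disc upper_half_plane \<and> \<alpha> > 1 \<and>
          (\<forall>w\<in>upper_half_plane. h (\<phi> (inv_into unit_disc h w)) = of_real \<alpha> * w) \<and>
          D = {z \<in> unit_disc. 1 \<le> cmod (h z) \<and> cmod (h z) < \<alpha>})) \<or>
     (parabolic_automorphism \<phi> \<and>
       (\<exists>h. \<exists>t::real. conformal_map h unit_disc upper_half_plane \<and> t \<noteq> 0 \<and>
          (\<forall>w\<in>upper_half_plane. h (\<phi> (inv_into unit_disc h w)) = w + of_real t) \<and>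
          D = {z \<in> unit_disc. 0 \<le> Re (h z) \<and> Re (h z) < \<bar>t\<bar>}))"

text \<open>The circle \<open>sphere c r\<close> is a horocycle at \<open>\<xi>\<close>. A circle of radius less than 1 contained in the
  closed unit disc is internally tangent to the unit circle at \<open>\<xi>\<close> exactly if \<open>\<xi>\<close> is the (only)
  point where the two circles meet. The open disc that it bounds is \<open>ball c r\<close>.\<close>

definition horocycle_at :: "complex \<Rightarrow> complex \<Rightarrow> real \<Rightarrow> bool" where
  "horocycle_at \<xi> c r \<longleftrightarrow>
     0 < r \<and> r < 1 \<and> sphere c r \<subseteq> cball 0 1 \<and> sphere c r \<inter> sphere 0 1 = {\<xi>}"

end

theory Submission
  imports Defs
begin

text \<open>
  Everything is transported to the upper half-plane by the linearizing map \<open>h\<close>. By the Schwarz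
  lemma \<open>h\<close> is a Moebius map with a single pole \<open>\<eta>\<close> on the unit circle
  (\<open>conformal_map_half_plane_form\<close>), and this gives two translations of the data.

  First, \<open>1 - \<bar>z\<bar>\<close> is comparable to \<open>Im w / (1 + \<bar>w\<bar>\<^sup>2)\<close> for \<open>w = h z\<close>, so being a Blaschke
  sequence means summability of these weights (\<open>blaschke_sequence_iff_half_plane\<close>). Secondly,
  \<open>Im h\<close> is a multiple of the Poisson kernel with pole \<open>\<eta>\<close>, so staying outside of a horocycle at
  \<open>\<eta>\<close> means that \<open>Im w\<close> is bounded (\<open>avoids_horodisc_iff_Im_bounded\<close>).

  In the hyperbolic case the orbit of \<open>w\<close> is \<open>\<alpha>\<^sup>n w\<close>. Since \<open>\<bar>w\<bar>\<close> is bounded above and below on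
  the fundamental domain, the weight of \<open>\<alpha>\<^sup>n w\<close> is at most a constant times \<open>\<alpha>\<close> to the power
  \<open>-\<bar>n\<bar>\<close> times the weight of \<open>w\<close>, and the double series is dominated by a product of two
  convergent series.

  In the parabolic case the orbit is \<open>w + n t\<close> with \<open>Re w\<close> bounded. If the heights \<open>Im w\<close> are
  bounded by \<open>M\<close>, the weight of \<open>w + n t\<close> is at most a constant times \<open>1 / (1 + n\<^sup>2)\<close> times the
  weight of \<open>w\<close>, and the series again converges. Conversely, if \<open>y = Im w\<close> is large, about \<open>y /
  \<bar>t\<bar>\<close> points of the orbit have weight at least \<open>1 / (6 y)\<close>, so the whole orbit contributes at
  least \<open>1 / (6 \<bar>t\<bar>)\<close>; this can happen for only finitely many orbits in a convergent series, and
  hence the heights are bounded. Finally the fixed point of a parabolic \<open>\<phi>\<close> is the pole \<open>\<eta>\<close>,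
  because elsewhere \<open>h\<close> is continuous and its value would be invariant under a nontrivial
  translation (\<open>parabolic_fixed_point_is_pole\<close>).
\<close>

section \<open>Conformal maps from the disc to the half-plane\<close>

lemma half_plane_norm_less:
  assumes "Im p > 0" "Im w > 0"
  shows "cmod (w - p) < cmod (w - cnj p)"
proof -
  have "Im p * Im w > 0" using assms by simp
  then have "(cmod (w - p))\<^sup>2 < (cmod (w - cnj p))\<^sup>2"
    unfolding cmod_power2 by (simp add: power2_eq_square algebra_simps)
  then show ?thesis by (rule power_less_imp_less_base) simp
qed

text \<open>After multiplication by \<open>cnj (\<eta> - z)\<close> the mixed terms of the numerator are conjugate to each
  other, so they do not contribute to the imaginary part; what remains is a multiple of the
  Poisson kernel of the disc with pole \<open>\<eta>\<close>.\<close>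

lemma Im_half_plane_form:
  assumes "cmod \<eta> = 1"
  shows "Im ((\<eta> * p - cnj p * z) / (\<eta> - z)) = Im p * ((1 - (cmod z)\<^sup>2) / (cmod (\<eta> - z))\<^sup>2)"
proof -
  have "\<eta> * cnj \<eta> = 1" using complex_norm_square[of \<eta>] assms by simp
  have "Im ((\<eta> * p - cnj p * z) / (\<eta> - z)) =
        Im ((\<eta> * p - cnj p * z) * cnj (\<eta> - z)) / (cmod (\<eta> - z))\<^sup>2"
    by (subst complex_div_cnj) (simp only: Im_divide_of_real flip: of_real_power)
  also have "(\<eta> * p - cnj p * z) * cnj (\<eta> - z)
      = (\<eta> * cnj \<eta>) * p + cnj p * (z * cnj z) - (p * \<eta> * cnj z + cnj (p * \<eta> * cnj z))"
    by (simp add: algebra_simps)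
  also have "Im \<dots> = Im p * (1 - (cmod z)\<^sup>2)"
    unfolding \<open>\<eta> * cnj \<eta> = 1\<close> complex_add_cnj complex_norm_square[symmetric]
    using assms by (simp add: algebra_simps flip: of_real_power)
  finally show ?thesis by simp
qed

text \<open>Composing \<open>h\<close> with the Moebius map \<open>w \<mapsto> (w - p) / (w - cnj p)\<close>, where \<open>p = h 0\<close>, gives an
  automorphism \<open>g\<close> of the disc fixing 0. The Schwarz lemma applied to \<open>g\<close> and to its inverse
  makes \<open>g\<close> a rotation \<open>z \<mapsto> \<alpha> z\<close>, and solving for \<open>h\<close> gives the formula, with pole \<open>\<eta> = cnj \<alpha>\<close>.\<close>

lemma conformal_map_half_plane_form:
  assumes "conformal_map h unit_disc upper_half_plane"
  obtains \<eta> p where "cmod \<eta> = 1" "Im p > 0"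
    "\<And>z. z \<in> unit_disc \<Longrightarrow> h z = (\<eta> * p - cnj p * z) / (\<eta> - z)"
proof -
  have hol: "h holomorphic_on unit_disc" and bij: "bij_betw h unit_disc upper_half_plane"
    using assms by (auto simp: conformal_map_def)
  define p where "p = h 0"
  have inH: "Im (h z) > 0" if "z \<in> unit_disc" for z
    using bij_betwE[OF bij] that by (auto simp: upper_half_plane_def)
  have p: "Im p > 0" using inH[of 0] by (simp add: p_def)
  have ne: "h z - cnj p \<noteq> 0" if "z \<in> unit_disc" for z
  proof
    assume "h z - cnj p = 0"
    then have "Im (h z) = - Im p" by (simp add: complex_eq_iff)
    with inH[OF that] p show False by linarith
  qed
  define g where "g z = (h z - p) / (h z - cnj p)" for z
  have g_hol: "g holomorphic_on unit_disc"
    unfolding g_def using ne by (intro holomorphic_intros hol) auto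
  have g_in: "cmod (g z) < 1" if "z \<in> unit_disc" for z
    using half_plane_norm_less[OF p inH[OF that]] ne[OF that]
    by (simp add: g_def norm_divide divide_less_eq)
  have g_inv: "h z = (p - cnj p * g z) / (1 - g z)" "1 - g z \<noteq> 0" if "z \<in> unit_disc" for z
  proof -
    show "1 - g z \<noteq> 0" using g_in[OF that] by auto
    have "g z * (h z - cnj p) = h z - p" using ne[OF that] by (simp add: g_def)
    then have "h z * (1 - g z) = p - cnj p * g z" by (simp add: algebra_simps)
    then show "h z = (p - cnj p * g z) / (1 - g z)" using \<open>1 - g z \<noteq> 0\<close>
      by (simp add: eq_divide_eq)
  qed
  have g_inj: "inj_on g unit_disc"
  proof (rule inj_onI)
    fix x y assume "x \<in> unit_disc" "y \<in> unit_disc" "g x = g y"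
    then have "h x = h y" using g_inv(1) by metis
    then show "x = y" using bij \<open>x \<in> unit_disc\<close> \<open>y \<in> unit_disc\<close>
      by (meson bij_betw_imp_inj_on inj_onD)
  qed
  have g_surj: "\<exists>z\<in>unit_disc. g z = u" if u: "u \<in> unit_disc" for u
  proof -
    define w where "w = (p - cnj p * u) / (1 - u)"
    have u1: "1 - u \<noteq> 0" using u by auto
    have "Im w = Im p * ((1 - (cmod u)\<^sup>2) / (cmod (1 - u))\<^sup>2)"
      using Im_half_plane_form[of 1 p u] by (simp add: w_def)
    also have "\<dots> > 0"
      using p u u1 by (intro divide_pos_pos mult_pos_pos) (auto simp: abs_square_less_1)
    finally have "w \<in> upper_half_plane" by (simp add: upper_half_plane_def)
    then obtain z where z: "z \<in> unit_disc" "h z = w"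
      by (metis bij bij_betw_imp_surj_on imageE)
    have "w - p = (p - cnj p) * u / (1 - u)" "w - cnj p = (p - cnj p) / (1 - u)"
      using u1 by (simp_all add: w_def field_simps)
    moreover have "p - cnj p \<noteq> 0" using p by (auto simp: complex_eq_iff)
    ultimately have "g z = u" using u1 by (simp add: g_def z(2))
    with z show ?thesis by blast
  qed
  have g0: "g 0 = 0" by (simp add: g_def p_def)
  obtain k where k: "k holomorphic_on g ` unit_disc" "\<And>z. z \<in> unit_disc \<Longrightarrow> k (g z) = z"
    using holomorphic_has_inverse[OF g_hol open_ball g_inj] by metis
  have "g ` unit_disc = unit_disc"
    using g_in g_surj by (force simp: image_iff)
  with k have k_hol: "k holomorphic_on unit_disc" by simp
  have k_in: "cmod (k u) < 1" if "cmod u < 1" for u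
    using g_surj[of u] that k(2) by auto
  have k0: "k 0 = 0" using k(2)[of 0] g0 by simp
  \<comment> \<open>Equality in the Schwarz lemma is needed at one nonzero point only; any would do.\<close>
  define s :: complex where "s = 1 / 2"
  have s: "cmod s < 1" "s \<noteq> 0" by (simp_all add: s_def norm_divide)
  have "cmod (g s) \<le> cmod s"
    using Schwarz_Lemma(1)[OF g_hol g0] g_in s by simp
  moreover have "cmod (k (g s)) \<le> cmod (g s)"
    using Schwarz_Lemma(1)[OF k_hol k0] k_in g_in s by simp
  ultimately have "cmod (g s) = cmod s" using k(2)[of s] s by simp
  then obtain \<alpha> where \<alpha>: "\<And>z. cmod z < 1 \<Longrightarrow> g z = \<alpha> * z" "cmod \<alpha> = 1"
    using Schwarz_Lemma(3)[OF g_hol g0] g_in s by (metis mem_ball_0)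
  define \<eta> where "\<eta> = cnj \<alpha>"
  have \<eta>: "\<alpha> * \<eta> = 1" "cmod \<eta> = 1"
    using \<alpha>(2) complex_norm_square[of \<alpha>] by (simp_all add: \<eta>_def)
  show thesis
  proof (rule that[OF \<eta>(2) p])
    fix z assume z: "z \<in> unit_disc"
    have "h z = (p - cnj p * (\<alpha> * z)) / (1 - \<alpha> * z)"
      using g_inv[OF z] \<alpha>(1)[of z] z by simp
    also have "\<dots> = (\<eta> * (p - cnj p * (\<alpha> * z))) / (\<eta> * (1 - \<alpha> * z))"
      using \<eta> by (intro mult_divide_mult_cancel_left[symmetric]) auto
    also have "\<eta> * (1 - \<alpha> * z) = \<eta> - (\<alpha> * \<eta>) * z" by (simp add: algebra_simps)
    also have "\<eta> * (p - cnj p * (\<alpha> * z)) = \<eta> * p - (\<alpha> * \<eta>) * cnj p * z" by (simp add: algebra_simps)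
    finally show "h z = (\<eta> * p - cnj p * z) / (\<eta> - z)" by (simp add: \<eta>(1))
  qed
qed

section \<open>The Blaschke condition in the half-plane\<close>

text \<open>Up to constant factors, the distance to the unit circle of the point of the disc corresponding
  to \<open>w\<close>.\<close>

definition half_plane_weight :: "complex \<Rightarrow> real" where
  "half_plane_weight w = Im w / (1 + (cmod w)\<^sup>2)"

lemma half_plane_weight_pos: "Im w > 0 \<Longrightarrow> half_plane_weight w > 0"
  unfolding half_plane_weight_def by (intro divide_pos_pos) (auto simp: add_pos_nonneg)

text \<open>With \<open>w = h z\<close>, the explicit form of \<open>h\<close> gives \<open>1 - \<bar>z\<bar>\<^sup>2 = 4 Im p Im w / q\<close> with \<open>q = \<bar>w -
  cnj p\<bar>\<^sup>2\<close>. The denominators \<open>q\<close> and \<open>1 + \<bar>w\<bar>\<^sup>2\<close> are comparable because \<open>cnj p\<close> is a fixed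
  point of the lower half-plane, which keeps \<open>q\<close> away from 0.\<close>

lemma boundary_distance_comparable:
  assumes "conformal_map h unit_disc upper_half_plane"
  obtains A B where "A > 0" "B > 0"
    "\<And>z. z \<in> unit_disc \<Longrightarrow> A * half_plane_weight (h z) \<le> 1 - cmod z"
    "\<And>z. z \<in> unit_disc \<Longrightarrow> 1 - cmod z \<le> B * half_plane_weight (h z)"
proof -
  obtain \<eta> p where \<eta>: "cmod \<eta> = 1" and p: "Im p > 0"
    and h: "\<And>z. z \<in> unit_disc \<Longrightarrow> h z = (\<eta> * p - cnj p * z) / (\<eta> - z)"
    using conformal_map_half_plane_form[OF assms] by blast
  define A where "A = Im p / (1 + (cmod p)\<^sup>2)"
  define B where "B = 4 * Im p * (2 + (1 + 2 * (cmod p)\<^sup>2) / (Im p)\<^sup>2)"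
  have *: "A * half_plane_weight (h z) \<le> 1 - cmod z \<and> 1 - cmod z \<le> B * half_plane_weight (h z)"
    if z: "z \<in> unit_disc" for z
  proof -
    define w where "w = h z"
    define q where "q = (cmod (w - cnj p))\<^sup>2"
    have ne: "\<eta> - z \<noteq> 0" using \<eta> z by auto
    have "w - cnj p = \<eta> * (p - cnj p) / (\<eta> - z)"
      using ne by (simp add: w_def h[OF z] field_simps)
    moreover have "cmod (p - cnj p) = 2 * Im p"
      using p by (simp add: complex_diff_cnj norm_mult)
    ultimately have "cmod (w - cnj p) = 2 * Im p / cmod (\<eta> - z)"
      by (simp add: norm_divide norm_mult \<eta>)
    then have q_eq: "q = 4 * (Im p)\<^sup>2 / (cmod (\<eta> - z))\<^sup>2"
      by (simp add: q_def power_divide)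
    have Imw: "Im w = Im p * ((1 - (cmod z)\<^sup>2) / (cmod (\<eta> - z))\<^sup>2)"
      by (simp add: w_def h[OF z] Im_half_plane_form[OF \<eta>])
    have eq: "1 - (cmod z)\<^sup>2 = 4 * Im p * Im w / q"
      unfolding q_eq Imw using ne p by (simp add: field_simps power2_eq_square)
    have w: "Im w > 0" using assms z unfolding w_def
      by (auto simp: conformal_map_def upper_half_plane_def bij_betw_def)
    have tri: "(a + b)\<^sup>2 \<le> 2 * a\<^sup>2 + 2 * b\<^sup>2" for a b :: real
      using sum_squares_bound[of a b] by (simp add: power2_sum)
    have "q \<le> (cmod w + cmod p)\<^sup>2"
      unfolding q_def by (intro power_mono) (use norm_triangle_ineq4[of w "cnj p"] in auto)
    also have "\<dots> \<le> 2 * (cmod w)\<^sup>2 + 2 * (cmod p)\<^sup>2" by (rule tri)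
    also have "\<dots> \<le> 2 * (1 + (cmod p)\<^sup>2) * (1 + (cmod w)\<^sup>2)"
      by (simp add: algebra_simps)
    finally have q_le: "q \<le> 2 * (1 + (cmod p)\<^sup>2) * (1 + (cmod w)\<^sup>2)" .
    have "Im p \<le> \<bar>Im (w - cnj p)\<bar>" using w by simp
    also have "\<dots> \<le> cmod (w - cnj p)" by (rule abs_Im_le_cmod)
    finally have q_ge: "(Im p)\<^sup>2 \<le> q" unfolding q_def using p by (intro power_mono) auto
    have q0: "q > 0" using q_ge p by (meson less_le_trans zero_less_power)
    have "(cmod w)\<^sup>2 \<le> (cmod (w - cnj p) + cmod p)\<^sup>2"
      by (intro power_mono) (use norm_triangle_ineq[of "w - cnj p" "cnj p"] in auto)
    also have "\<dots> \<le> 2 * q + 2 * (cmod p)\<^sup>2" unfolding q_def by (rule tri)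
    finally have "1 + (cmod w)\<^sup>2 \<le> 2 * q + (1 + 2 * (cmod p)\<^sup>2)" by simp
    also have "1 + 2 * (cmod p)\<^sup>2 \<le> (1 + 2 * (cmod p)\<^sup>2) / (Im p)\<^sup>2 * q"
    proof -
      have "(1 + 2 * (cmod p)\<^sup>2) / (Im p)\<^sup>2 * (Im p)\<^sup>2 \<le> (1 + 2 * (cmod p)\<^sup>2) / (Im p)\<^sup>2 * q"
        by (intro mult_left_mono q_ge) (auto intro!: divide_nonneg_nonneg add_nonneg_nonneg)
      then show ?thesis using p by simp
    qed
    finally have w_le: "1 + (cmod w)\<^sup>2 \<le> (2 + (1 + 2 * (cmod p)\<^sup>2) / (Im p)\<^sup>2) * q"
      by (simp add: algebra_simps)
    have pos: "1 + (cmod w)\<^sup>2 > 0" "1 + (cmod p)\<^sup>2 > 0" by (auto simp: add_pos_nonneg)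
    have z1: "cmod z < 1" using z by simp
    have "(cmod z)\<^sup>2 \<le> cmod z * 1"
      unfolding power2_eq_square using z1 by (intro mult_left_mono) auto
    moreover have "0 \<le> (1 - cmod z)\<^sup>2" by simp
    ultimately have z2: "1 - cmod z \<le> 1 - (cmod z)\<^sup>2" "1 - (cmod z)\<^sup>2 \<le> 2 * (1 - cmod z)"
      by (simp_all add: power2_diff)
    have "2 * (a / P * (b / W)) = 4 * a * b / (2 * P * W)" if "P > 0" "W > 0" for a b P W :: real
      using that by (simp add: field_simps)
    from this[OF pos(2) pos(1), of "Im p" "Im w"]
    have "2 * (A * half_plane_weight w) = 4 * Im p * Im w / (2 * (1 + (cmod p)\<^sup>2) * (1 + (cmod w)\<^sup>2))"
      by (simp only: A_def half_plane_weight_def)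
    also have "\<dots> \<le> 4 * Im p * Im w / q"
      using q_le q0 p w by (intro divide_left_mono) (auto intro!: mult_pos_pos pos)
    also have "\<dots> \<le> 2 * (1 - cmod z)" using z2(2) unfolding eq .
    finally have 1: "A * half_plane_weight w \<le> 1 - cmod z" by simp
    have "1 - cmod z \<le> 4 * Im p * Im w * (1 / q)" using z2(1) unfolding eq by simp
    also have "\<dots> \<le> 4 * Im p * Im w * ((2 + (1 + 2 * (cmod p)\<^sup>2) / (Im p)\<^sup>2) / (1 + (cmod w)\<^sup>2))"
    proof (intro mult_left_mono)
      show "1 / q \<le> (2 + (1 + 2 * (cmod p)\<^sup>2) / (Im p)\<^sup>2) / (1 + (cmod w)\<^sup>2)"
        using w_le q0 pos by (simp add: le_divide_eq divide_le_eq)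
    qed (use p w in auto)
    also have "\<dots> = B * half_plane_weight w"
      by (simp add: B_def half_plane_weight_def)
    finally have 2: "1 - cmod z \<le> B * half_plane_weight w" .
    from 1 2 show ?thesis by (simp add: w_def)
  qed
  have "A > 0" unfolding A_def using p by (intro divide_pos_pos) (auto simp: add_pos_nonneg)
  moreover have "B > 0" unfolding B_def using p by (intro mult_pos_pos add_pos_nonneg) auto
  ultimately show thesis using that * by blast
qed

lemma blaschke_sequence_iff_half_plane:
  assumes h: "conformal_map h unit_disc upper_half_plane" and w: "\<And>i. i \<in> I \<Longrightarrow> w i \<in> unit_disc"
  shows "blaschke_sequence I w \<longleftrightarrow> (\<lambda>i. half_plane_weight (h (w i))) summable_on I"
proof -
  obtain A B where A: "A > 0" "B > 0"
    and le: "\<And>z. z \<in> unit_disc \<Longrightarrow> A * half_plane_weight (h z) \<le> 1 - cmod z"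
    and ge: "\<And>z. z \<in> unit_disc \<Longrightarrow> 1 - cmod z \<le> B * half_plane_weight (h z)"
    using boundary_distance_comparable[OF h] by blast
  have nn: "half_plane_weight (h z) \<ge> 0" if "z \<in> unit_disc" for z
    using h that by (intro less_imp_le half_plane_weight_pos)
      (auto simp: conformal_map_def upper_half_plane_def bij_betw_def)
  show ?thesis
  proof
    assume "blaschke_sequence I w"
    then have "(\<lambda>i. 1 - cmod (w i)) summable_on I" by (simp add: blaschke_sequence_def)
    then have "(\<lambda>i. A * half_plane_weight (h (w i))) summable_on I"
      by (rule summable_on_comparison_test) (use w le nn A in auto)
    then show "(\<lambda>i. half_plane_weight (h (w i))) summable_on I"
      using A by (simp add: summable_on_cmult_right')
  next
    assume "(\<lambda>i. half_plane_weight (h (w i))) summable_on I"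
    then have "(\<lambda>i. B * half_plane_weight (h (w i))) summable_on I"
      by (rule summable_on_cmult_right)
    then have "(\<lambda>i. 1 - cmod (w i)) summable_on I"
      by (rule summable_on_comparison_test) (use w ge in \<open>auto simp: less_imp_le\<close>)
    then show "blaschke_sequence I w" using w by (simp add: blaschke_sequence_def)
  qed
qed

section \<open>Horocycles\<close>

text \<open>The point \<open>(1 - r) \<xi>\<close> divides the segment from the origin to \<open>\<xi>\<close> in the ratio \<open>1 - r : r\<close>, so
  this is Stewart's theorem for the distances from \<open>z\<close>. On the circle of radius \<open>r\<close> about it the
  left-hand side is \<open>r\<^sup>2\<close>, and what remains is a level set of the Poisson kernel at \<open>\<xi>\<close>.\<close>

lemma dist_horocycle_centre_squared:
  assumes "cmod \<xi> = 1"
  shows "(cmod (of_real (1 - r) * \<xi> - z))\<^sup>2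
         = (1 - r) * (cmod (\<xi> - z))\<^sup>2 + r * (cmod z)\<^sup>2 - r + r\<^sup>2"
proof -
  have "(cmod (of_real (1 - r) * \<xi> - z))\<^sup>2
      = (1 - r) * (cmod (\<xi> - z))\<^sup>2 + r * (cmod z)\<^sup>2 - r * (1 - r) * (cmod \<xi>)\<^sup>2"
    unfolding cmod_power2 by (simp add: algebra_simps power2_eq_square)
  then show ?thesis by (simp add: assms algebra_simps power2_eq_square)
qed

text \<open>Tangency at \<open>\<xi>\<close> fixes the centre: the point of the circle farthest from the origin has modulus
  \<open>\<bar>c\<bar> + r\<close>, which is at most 1 because the circle lies in the closed disc and at least 1
  because \<open>\<xi>\<close> is on the circle. So that farthest point is on the unit circle and must be \<open>\<xi>\<close>
  itself.\<close>

lemma horocycle_at_iff: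
  assumes "cmod \<xi> = 1"
  shows "horocycle_at \<xi> c r \<longleftrightarrow> 0 < r \<and> r < 1 \<and> c = of_real (1 - r) * \<xi>"
proof
  assume hc: "horocycle_at \<xi> c r"
  then have r: "0 < r" "r < 1" and sub: "sphere c r \<subseteq> cball 0 1"
    and int: "sphere c r \<inter> sphere 0 1 = {\<xi>}" by (auto simp: horocycle_at_def)
  have "dist c \<xi> = r" using int by auto
  then have le: "1 \<le> cmod c + r"
    using assms norm_triangle_ineq[of c "\<xi> - c"] by (simp add: dist_norm norm_minus_commute)
  with r have c0: "c \<noteq> 0" by auto
  define u where "u = c / of_real (cmod c)"
  have u: "cmod u = 1" "c = of_real (cmod c) * u" using c0 by (simp_all add: u_def norm_divide)
  define q where "q = of_real (cmod c + r) * u"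
  have "q - c = of_real r * u" using u(2) by (simp add: q_def algebra_simps)
  then have "dist c q = r" using r u(1) by (simp add: dist_norm norm_minus_commute[of c q] norm_mult)
  then have qs: "q \<in> sphere c r" by simp
  have nq: "cmod q = cmod c + r"
    using r u(1) by (simp add: q_def norm_mult del: of_real_add)
  have "cmod q \<le> 1" using qs sub by auto
  with le nq have one: "cmod c + r = 1" by simp
  then have "q \<in> sphere 0 1" using nq by simp
  then have "q = \<xi>" using int qs by blast
  then have "u = \<xi>" using one by (simp add: q_def)
  moreover have "cmod c = 1 - r" using one by simp
  ultimately show "0 < r \<and> r < 1 \<and> c = of_real (1 - r) * \<xi>" using u(2) r by metis
next
  assume "0 < r \<and> r < 1 \<and> c = of_real (1 - r) * \<xi>"
  then have r: "0 < r" "r < 1" and c: "c = of_real (1 - r) * \<xi>" by auto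
  have nc: "cmod c = 1 - r" using r assms by (simp add: c norm_mult del: of_real_diff)
  have "sphere c r \<subseteq> cball 0 1"
  proof
    fix x assume "x \<in> sphere c r"
    then show "x \<in> cball 0 1"
      using nc norm_triangle_ineq[of c "x - c"] by (simp add: dist_norm norm_minus_commute)
  qed
  moreover have "sphere c r \<inter> sphere 0 1 = {\<xi>}"
  proof (intro equalityI subsetI)
    fix x assume "x \<in> sphere c r \<inter> sphere 0 1"
    then have x: "cmod (x - c) = r" "cmod x = 1" by (auto simp: dist_norm norm_minus_commute)
    have "r\<^sup>2 = (1 - r) * (cmod (\<xi> - x))\<^sup>2 + r\<^sup>2"
      using dist_horocycle_centre_squared[OF assms, of r x] x
      by (simp add: c norm_minus_commute del: of_real_diff)
    then show "x \<in> {\<xi>}" using r by simp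
  next
    fix x assume "x \<in> {\<xi>}"
    then have "x - c = of_real r * \<xi>" by (simp add: c algebra_simps)
    then have "cmod (x - c) = r" using r assms by (simp add: norm_mult)
    then show "x \<in> sphere c r \<inter> sphere 0 1"
      using \<open>x \<in> {\<xi>}\<close> assms by (auto simp: dist_norm norm_minus_commute)
  qed
  ultimately show "horocycle_at \<xi> c r" using r by (auto simp: horocycle_at_def)
qed

text \<open>Horodiscs at \<open>\<xi>\<close> are the superlevel sets of the Poisson kernel with pole \<open>\<xi>\<close>.\<close>

lemma mem_horodisc_iff:
  assumes "cmod \<xi> = 1" "0 < r" "r < 1" "z \<in> unit_disc"
  shows "z \<in> ball (of_real (1 - r) * \<xi>) r \<longleftrightarrow> (1 - r) / r < (1 - (cmod z)\<^sup>2) / (cmod (\<xi> - z))\<^sup>2"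
proof -
  have ne: "\<xi> \<noteq> z" using assms by auto
  define c where "c = of_real (1 - r) * \<xi>"
  have eq: "(cmod (c - z))\<^sup>2 = (1 - r) * (cmod (\<xi> - z))\<^sup>2 + r * (cmod z)\<^sup>2 - r + r\<^sup>2"
    unfolding c_def by (rule dist_horocycle_centre_squared[OF assms(1)])
  have "r \<le> cmod (c - z) \<longleftrightarrow> r\<^sup>2 \<le> (cmod (c - z))\<^sup>2"
    using abs_le_square_iff[of r "cmod (c - z)"] assms(2) by simp
  then have "z \<in> ball c r \<longleftrightarrow> (cmod (c - z))\<^sup>2 < r\<^sup>2"
    unfolding mem_ball dist_norm not_le[symmetric] by (rule arg_cong)
  also have "\<dots> \<longleftrightarrow> (1 - r) * (cmod (\<xi> - z))\<^sup>2 < r * (1 - (cmod z)\<^sup>2)"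
    unfolding eq by (auto simp: algebra_simps)
  also have "\<dots> \<longleftrightarrow> (1 - r) / r < (1 - (cmod z)\<^sup>2) / (cmod (\<xi> - z))\<^sup>2"
    using assms(2) ne by (simp add: field_simps)
  finally show ?thesis by (simp add: c_def)
qed

text \<open>Under a conformal map to the half-plane with pole \<open>\<eta>\<close>, the Poisson kernel at \<open>\<eta>\<close> becomes a
  multiple of the height \<open>Im h\<close>, so horodiscs at \<open>\<eta>\<close> correspond to half-planes \<open>{Im w > M}\<close>.\<close>

lemma avoids_horodisc_iff_Im_bounded:
  assumes \<eta>: "cmod \<eta> = 1" and p: "Im p > 0"
    and h: "\<And>z. z \<in> unit_disc \<Longrightarrow> h z = (\<eta> * p - cnj p * z) / (\<eta> - z)"
    and S: "S \<subseteq> unit_disc"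
  shows "(\<exists>c r. horocycle_at \<eta> c r \<and> S \<inter> ball c r = {}) \<longleftrightarrow> (\<exists>M. \<forall>z\<in>S. Im (h z) \<le> M)"
proof -
  have Im: "Im (h z) = Im p * ((1 - (cmod z)\<^sup>2) / (cmod (\<eta> - z))\<^sup>2)" if "z \<in> S" for z
    using that S by (simp add: h subset_iff Im_half_plane_form[OF \<eta>])
  have avoid: "S \<inter> ball (of_real (1 - r) * \<eta>) r = {} \<longleftrightarrow> (\<forall>z\<in>S. Im (h z) \<le> Im p * ((1 - r) / r))"
    if r: "0 < r" "r < 1" for r
  proof -
    have "z \<in> ball (of_real (1 - r) * \<eta>) r \<longleftrightarrow> \<not> Im (h z) \<le> Im p * ((1 - r) / r)" if "z \<in> S" for z
      unfolding Im[OF that] mult_le_cancel_left_pos[OF p] not_le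
      using that S by (intro mem_horodisc_iff \<eta> r) auto
    then show ?thesis by blast
  qed
  show ?thesis
  proof
    assume "\<exists>c r. horocycle_at \<eta> c r \<and> S \<inter> ball c r = {}"
    then show "\<exists>M. \<forall>z\<in>S. Im (h z) \<le> M"
      using avoid by (auto simp: horocycle_at_iff[OF \<eta>])
  next
    assume "\<exists>M. \<forall>z\<in>S. Im (h z) \<le> M"
    then obtain M where M: "\<And>z. z \<in> S \<Longrightarrow> Im (h z) \<le> M" by blast
    \<comment> \<open>The level of a horocycle of radius below 1 is positive, whereas the bound \<open>M\<close> may be negative
      when \<open>S\<close> is empty; hence the maximum.\<close>
    define N where "N = max 1 M / Im p"
    have N: "N > 0" "M \<le> Im p * N" using p by (auto simp: N_def less_max_iff_disj)
    define r where "r = 1 / (1 + N)"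
    have r: "0 < r" "r < 1" "(1 - r) / r = N" using N(1) by (auto simp: r_def field_simps)
    have "S \<inter> ball (of_real (1 - r) * \<eta>) r = {}"
      using avoid[OF r(1,2)] M N(2) by (auto simp: r(3) intro: order_trans)
    then show "\<exists>c r. horocycle_at \<eta> c r \<and> S \<inter> ball c r = {}"
      using r by (auto simp: horocycle_at_iff[OF \<eta>])
  qed
qed

section \<open>Iterates in the half-plane\<close>

lemma conjugated_map:
  assumes "conformal_map h unit_disc upper_half_plane"
    and "\<And>w. w \<in> upper_half_plane \<Longrightarrow> h (\<phi> (inv_into unit_disc h w)) = F w"
    and "z \<in> unit_disc"
  shows "h (\<phi> z) = F (h z)"
proof -
  have bij: "bij_betw h unit_disc upper_half_plane"
    using assms(1) by (simp add: conformal_map_def)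
  then have "inv_into unit_disc h (h z) = z"
    using assms(3) by (rule bij_betw_inv_into_left)
  moreover have "h z \<in> upper_half_plane" using bij assms(3) by (rule bij_betw_apply)
  ultimately show ?thesis using assms(2)[of "h z"] by simp
qed

text \<open>\<open>F\<close> is the action of the integers generated by the linear model, \<open>F n w = \<alpha>\<^sup>n w\<close> or \<open>F n w = w
  + n t\<close>; the group law is all that is needed to follow forward and backward iterates at once.\<close>

lemma disc_iterate_linearized:
  fixes F :: "int \<Rightarrow> complex \<Rightarrow> complex"
  assumes \<phi>: "disc_automorphism \<phi>"
    and conj: "\<And>z. z \<in> unit_disc \<Longrightarrow> h (\<phi> z) = F 1 (h z)"
    and F0: "\<And>w. F 0 w = w" and F_add: "\<And>m n w. F (m + n) w = F m (F n w)"
    and z: "z \<in> unit_disc"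
  shows "disc_iterate \<phi> n z \<in> unit_disc \<and> h (disc_iterate \<phi> n z) = F n (h z)"
proof -
  have bij: "bij_betw \<phi> unit_disc unit_disc"
    using \<phi> by (simp add: disc_automorphism_def conformal_map_def)
  define \<psi> where "\<psi> = inv_into unit_disc \<phi>"
  have \<phi>in: "\<phi> u \<in> unit_disc" if "u \<in> unit_disc" for u using bij that by (rule bij_betw_apply)
  have \<psi>in: "\<psi> u \<in> unit_disc" if "u \<in> unit_disc" for u
    using bij_betw_inv_into[OF bij] that unfolding \<psi>_def by (rule bij_betw_apply)
  have \<psi>: "h (\<psi> u) = F (-1) (h u)" if "u \<in> unit_disc" for u
  proof -
    have "\<phi> (\<psi> u) = u" using bij that by (simp add: \<psi>_def bij_betw_inv_into_right)
    then have "F (-1) (h u) = F (-1) (F 1 (h (\<psi> u)))" using conj[OF \<psi>in[OF that]] by simp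
    also have "\<dots> = h (\<psi> u)" using F_add[of "-1" 1] F0 by simp
    finally show ?thesis by simp
  qed
  have fwd: "(\<phi> ^^ k) z \<in> unit_disc \<and> h ((\<phi> ^^ k) z) = F (int k) (h z)" for k
  proof (induction k)
    case (Suc k)
    then show ?case using \<phi>in[of "(\<phi> ^^ k) z"] conj[of "(\<phi> ^^ k) z"] F_add[of 1 "int k" "h z"]
      by (simp add: add.commute)
  qed (use z F0 in simp)
  have bwd: "(\<psi> ^^ k) z \<in> unit_disc \<and> h ((\<psi> ^^ k) z) = F (- int k) (h z)" for k
  proof (induction k)
    case (Suc k)
    then show ?case using \<psi>in[of "(\<psi> ^^ k) z"] \<psi>[of "(\<psi> ^^ k) z"] F_add[of "-1" "- int k" "h z"]
      by simp
  qed (use z F0 in simp)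
  show ?thesis using fwd[of "nat n"] bwd[of "nat (- n)"] by (simp add: disc_iterate_def \<psi>_def)
qed

text \<open>At a point \<open>\<xi> \<noteq> \<eta>\<close> of the circle \<open>h\<close> would have a finite limit, both along \<open>z\<close> and along \<open>\<phi>
  z\<close>; but these values differ by \<open>t\<close>.\<close>

lemma parabolic_fixed_point_is_pole:
  fixes t :: real
  assumes \<phi>: "disc_automorphism \<phi>" and \<eta>: "cmod \<eta> = 1" and t: "t \<noteq> 0"
    and h: "\<And>z. z \<in> unit_disc \<Longrightarrow> h z = (\<eta> * p - cnj p * z) / (\<eta> - z)"
    and conj: "\<And>z. z \<in> unit_disc \<Longrightarrow> h (\<phi> z) = h z + of_real t"
    and \<xi>: "cmod \<xi> = 1" "(\<phi> \<longlongrightarrow> \<xi>) (at \<xi> within unit_disc)"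
  shows "\<xi> = \<eta>"
proof (rule ccontr)
  assume "\<xi> \<noteq> \<eta>"
  define f where "f z = (\<eta> * p - cnj p * z) / (\<eta> - z)" for z
  have \<phi>in: "\<phi> z \<in> unit_disc" if "z \<in> unit_disc" for z
    using \<phi> that unfolding disc_automorphism_def conformal_map_def by (blast intro: bij_betw_apply)
  have ev: "\<forall>\<^sub>F z in at \<xi> within unit_disc. z \<in> unit_disc"
    by (simp add: eventually_at_filter)
  have "(f \<longlongrightarrow> f \<xi>) (at \<xi> within unit_disc)" "((\<lambda>z. f (\<phi> z)) \<longlongrightarrow> f \<xi>) (at \<xi> within unit_disc)"
    unfolding f_def using \<open>\<xi> \<noteq> \<eta>\<close> by (intro tendsto_intros \<xi>; simp)+
  then have "((\<lambda>z. f (\<phi> z) - f z) \<longlongrightarrow> f \<xi> - f \<xi>) (at \<xi> within unit_disc)"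
    by (intro tendsto_diff)
  moreover have "\<forall>\<^sub>F z in at \<xi> within unit_disc. f (\<phi> z) - f z = of_real t"
    using ev
  proof eventually_elim
    case (elim z)
    have "f z = h z" "f (\<phi> z) = h (\<phi> z)" using h elim \<phi>in by (simp_all add: f_def)
    then show ?case using conj[OF elim] by simp
  qed
  ultimately have "((\<lambda>z. of_real t :: complex) \<longlongrightarrow> 0) (at \<xi> within unit_disc)"
    by (simp add: tendsto_cong)
  moreover have "at \<xi> within unit_disc \<noteq> bot"
    using \<xi>(1) by (simp add: trivial_limit_within islimpt_ball)
  ultimately have "of_real t = (0 :: complex)" by (simp add: tendsto_const_iff)
  with t show False by simp
qed

section \<open>Summation over orbits\<close>

lemma summable_on_int_even:
  fixes f :: "nat \<Rightarrow> real"
  assumes "summable f" "\<And>n. f n \<ge> 0"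
  shows "(\<lambda>n::int. f (nat \<bar>n\<bar>)) summable_on UNIV"
proof -
  have f: "f summable_on UNIV" using assms by (simp add: summable_on_UNIV_nonneg_real_iff)
  have "(\<lambda>n::int. f (nat \<bar>n\<bar>)) summable_on range int"
    using f by (subst summable_on_reindex) (auto simp: o_def)
  moreover have "(\<lambda>n::int. f (nat \<bar>n\<bar>)) summable_on range (\<lambda>n. - int n)"
    using f by (subst summable_on_reindex) (auto simp: o_def inj_on_def)
  moreover have "(UNIV :: int set) = range int \<union> range (\<lambda>n. - int n)"
    by (auto simp: image_iff) (metis int_cases2)
  ultimately show ?thesis by (metis summable_on_union)
qed

lemma summable_on_times_nonneg:
  fixes f :: "'a \<Rightarrow> real" and g :: "'b \<Rightarrow> real"
  assumes "f summable_on A" "g summable_on B"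
    and "\<And>x. x \<in> A \<Longrightarrow> f x \<ge> 0" "\<And>y. y \<in> B \<Longrightarrow> g y \<ge> 0"
  shows "(\<lambda>(x, y). f x * g y) summable_on A \<times> B"
proof (rule summable_on_SigmaI)
  show "((\<lambda>y. case (x, y) of (x, y) \<Rightarrow> f x * g y) has_sum f x * infsum g B) B" for x
    using assms(2) by (auto intro!: has_sum_cmult_right)
  show "(\<lambda>x. f x * infsum g B) summable_on A"
    using assms(1) by (rule summable_on_cmult_left)
qed (use assms in auto)

text \<open>On the annulus \<open>1 \<le> \<bar>w\<bar> < \<alpha>\<close> the weight is comparable to \<open>Im w\<close>, and for \<open>a = \<alpha>\<^sup>n\<close> the weight
  of \<open>a w\<close> is at most \<open>Im w\<close> times \<open>a / (1 + a\<^sup>2)\<close>, which is below both \<open>a\<close> and \<open>1 / a\<close>.\<close>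

lemma half_plane_weight_dilation_le:
  fixes \<alpha> :: real
  assumes "\<alpha> > 1" "Im w > 0" "1 \<le> cmod w" "cmod w < \<alpha>"
  shows "half_plane_weight (of_real (\<alpha> powi n) * w)
         \<le> (1 + \<alpha>\<^sup>2) * half_plane_weight w * (1 / \<alpha>) ^ nat \<bar>n\<bar>"
proof -
  define a where "a = \<alpha> powi n"
  have a: "a > 0" using assms(1) by (simp add: a_def)
  have cases: "(1 / \<alpha>) ^ nat \<bar>n\<bar> = (if n \<ge> 0 then 1 / a else a)"
    using assms(1) by (auto simp: a_def power_int_def field_simps)
  have "a / (1 + a\<^sup>2) \<le> a / a\<^sup>2" "a / (1 + a\<^sup>2) \<le> a / 1"
    using a by (intro divide_left_mono; simp add: add_pos_nonneg)+
  then have key: "a / (1 + a\<^sup>2) \<le> (1 / \<alpha>) ^ nat \<bar>n\<bar>"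
    unfolding cases using a by (auto simp: power2_eq_square)
  have "(cmod w)\<^sup>2 \<le> \<alpha>\<^sup>2" using assms by (intro power_mono) auto
  then have "Im w * (1 + (cmod w)\<^sup>2) \<le> Im w * (1 + \<alpha>\<^sup>2)" using assms by (intro mult_left_mono) auto
  then have Im_le: "Im w \<le> (1 + \<alpha>\<^sup>2) * half_plane_weight w"
    by (simp add: half_plane_weight_def le_divide_eq add_pos_nonneg mult.commute)
  have "half_plane_weight (of_real a * w) = a * Im w / (1 + a\<^sup>2 * (cmod w)\<^sup>2)"
    using a by (simp add: half_plane_weight_def norm_mult power_mult_distrib)
  also have "\<dots> \<le> a * Im w / (1 + a\<^sup>2 * 1)"
    using a assms by (intro divide_left_mono add_left_mono mult_left_mono mult_pos_pos)
      (auto simp: add_pos_nonneg)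
  also have "\<dots> = Im w * (a / (1 + a\<^sup>2))" by simp
  also have "\<dots> \<le> ((1 + \<alpha>\<^sup>2) * half_plane_weight w) * (1 / \<alpha>) ^ nat \<bar>n\<bar>"
    using key Im_le assms a by (intro mult_mono) (auto intro: order_trans[OF less_imp_le Im_le])
  finally show ?thesis by (simp add: a_def)
qed

text \<open>On the box \<open>0 \<le> Re w < \<bar>t\<bar>\<close>, \<open>Im w \<le> M\<close> the weight is comparable to \<open>Im w\<close>, and \<open>\<bar>Re w + n t\<bar>\<close>
  grows linearly in \<open>\<bar>n\<bar>\<close>.\<close>

lemma half_plane_weight_translation_le:
  fixes t M :: real
  assumes "t \<noteq> 0" "Im w > 0" "0 \<le> Re w" "Re w < \<bar>t\<bar>" "Im w \<le> M"
  shows "half_plane_weight (w + of_real (of_int n * t))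
         \<le> (1 + t\<^sup>2 + M\<^sup>2) * half_plane_weight w * ((3 + 2 / t\<^sup>2) * (1 / (1 + (of_int n)\<^sup>2)))"
proof -
  define x where "x = Re w + of_int n * t"
  have Re2: "(Re w)\<^sup>2 \<le> t\<^sup>2" using assms by (metis abs_of_nonneg less_imp_le abs_le_square_iff)
  have Im2: "(Im w)\<^sup>2 \<le> M\<^sup>2" using assms by (intro power_mono) auto
  have "1 + (cmod w)\<^sup>2 \<le> 1 + t\<^sup>2 + M\<^sup>2" using Re2 Im2 by (simp add: cmod_power2)
  then have "Im w * (1 + (cmod w)\<^sup>2) \<le> Im w * (1 + t\<^sup>2 + M\<^sup>2)" using assms by (intro mult_left_mono) auto
  then have Im_le: "Im w \<le> (1 + t\<^sup>2 + M\<^sup>2) * half_plane_weight w"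
    by (simp add: half_plane_weight_def le_divide_eq add_pos_nonneg mult.commute)
  \<comment> \<open>\<open>n t\<close> differs from \<open>x\<close> by less than \<open>\<bar>t\<bar>\<close>, so \<open>n\<^sup>2\<close> is controlled by \<open>x\<^sup>2\<close>.\<close>
  have "(of_int n * t)\<^sup>2 = (x - Re w)\<^sup>2" by (simp add: x_def)
  also have "\<dots> \<le> 2 * x\<^sup>2 + 2 * (Re w)\<^sup>2"
    using sum_squares_ge_zero[of "x + Re w" 0] by (simp add: power2_eq_square algebra_simps)
  finally have "(of_int n)\<^sup>2 * t\<^sup>2 \<le> 2 * x\<^sup>2 + 2 * t\<^sup>2" using Re2 by (simp add: power_mult_distrib)
  then have "(of_int n)\<^sup>2 \<le> 2 * x\<^sup>2 / t\<^sup>2 + 2" using assms(1) by (simp add: field_simps)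
  moreover have "0 \<le> 2 / t\<^sup>2 + 3 * x\<^sup>2" by simp
  ultimately have "1 + (of_int n)\<^sup>2 \<le> 3 + 2 * x\<^sup>2 / t\<^sup>2 + (2 / t\<^sup>2 + 3 * x\<^sup>2)" by linarith
  also have "\<dots> = (3 + 2 / t\<^sup>2) * (1 + x\<^sup>2)" by (simp add: algebra_simps add_divide_distrib)
  finally have x_ge: "1 / (1 + x\<^sup>2) \<le> (3 + 2 / t\<^sup>2) * (1 / (1 + (of_int n)\<^sup>2))"
    by (simp add: divide_le_eq le_divide_eq add_pos_nonneg mult.commute)
  have "half_plane_weight (w + of_real (of_int n * t)) = Im w / (1 + (x\<^sup>2 + (Im w)\<^sup>2))"
    by (simp add: half_plane_weight_def cmod_power2 x_def)
  also have "\<dots> \<le> Im w / (1 + x\<^sup>2)"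
    using assms by (intro divide_left_mono mult_pos_pos) (auto simp: add_pos_nonneg)
  also have "\<dots> = Im w * (1 / (1 + x\<^sup>2))" by simp
  also have "\<dots> \<le> ((1 + t\<^sup>2 + M\<^sup>2) * half_plane_weight w) * ((3 + 2 / t\<^sup>2) * (1 / (1 + (of_int n)\<^sup>2)))"
    using x_ge Im_le assms by (intro mult_mono) (auto intro: order_trans[OF less_imp_le Im_le])
  finally show ?thesis .
qed

text \<open>A high orbit contributes a definite amount, however high it is: with \<open>y = Im w\<close>, the
  translates with \<open>0 \<le> n \<le> y / \<bar>t\<bar>\<close> have real part at most \<open>2 y\<close>, hence weight at least \<open>y / (6
  y\<^sup>2)\<close>, and there are at least \<open>y / \<bar>t\<bar>\<close> of them.\<close>

lemma translation_orbit_weight_ge: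
  fixes t :: real
  assumes t: "t \<noteq> 0" and w: "1 \<le> Im w" "\<bar>t\<bar> \<le> Im w" "0 \<le> Re w" "Re w < \<bar>t\<bar>"
    and sum: "(\<lambda>n::int. half_plane_weight (w + of_real (of_int n * t))) summable_on UNIV"
  shows "1 / (6 * \<bar>t\<bar>) \<le> (\<Sum>\<^sub>\<infinity>n::int. half_plane_weight (w + of_real (of_int n * t)))"
proof -
  define y where "y = Im w"
  define N where "N = nat \<lfloor>y / \<bar>t\<bar>\<rfloor>"
  define J where "J = int ` {..N}"
  have y: "y \<ge> 1" using w by (simp add: y_def)
  have "0 \<le> y / \<bar>t\<bar>" using y by simp
  then have "real N = of_int \<lfloor>y / \<bar>t\<bar>\<rfloor>" by (simp add: N_def)
  then have N: "real N \<le> y / \<bar>t\<bar>" "y / \<bar>t\<bar> \<le> real N + 1" by linarith+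
  have each: "1 / (6 * y) \<le> half_plane_weight (w + of_real (of_int n * t))" if n: "n \<in> J" for n
  proof -
    define x where "x = Re w + of_int n * t"
    have "real_of_int n * \<bar>t\<bar> \<le> real N * \<bar>t\<bar>" "0 \<le> n"
      using n by (auto simp: J_def intro!: mult_right_mono)
    moreover have "real N * \<bar>t\<bar> \<le> y" using N(1) t by (simp add: le_divide_eq)
    moreover have "\<bar>x\<bar> \<le> \<bar>Re w\<bar> + \<bar>of_int n * t\<bar>" unfolding x_def by (rule abs_triangle_ineq)
    ultimately have "\<bar>x\<bar> \<le> 2 * y" using w by (simp add: abs_mult y_def)
    then have "x\<^sup>2 \<le> (2 * y)\<^sup>2" by (metis abs_ge_zero power2_abs power_mono)
    moreover have "1 \<le> y\<^sup>2" using y by simp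
    ultimately have le: "1 + (x\<^sup>2 + y\<^sup>2) \<le> 6 * y\<^sup>2" by simp
    have "1 / (6 * y) = y / (6 * y\<^sup>2)" using y by (simp add: power2_eq_square)
    also have "\<dots> \<le> y / (1 + (x\<^sup>2 + y\<^sup>2))"
      using le y by (intro divide_left_mono mult_pos_pos) (auto simp: add_pos_nonneg)
    also have "\<dots> = half_plane_weight (w + of_real (of_int n * t))"
      by (simp add: half_plane_weight_def cmod_power2 x_def y_def)
    finally show ?thesis .
  qed
  have "1 / (6 * \<bar>t\<bar>) = (y / \<bar>t\<bar>) * (1 / (6 * y))" using y by simp
  also have "\<dots> \<le> real (card J) * (1 / (6 * y))"
    using N y by (intro mult_right_mono) (auto simp: J_def card_image)
  also have "\<dots> = (\<Sum>n\<in>J. 1 / (6 * y))" by simp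
  also have "\<dots> \<le> (\<Sum>n\<in>J. half_plane_weight (w + of_real (of_int n * t)))"
    by (intro sum_mono each)
  also have "\<dots> \<le> (\<Sum>\<^sub>\<infinity>n. half_plane_weight (w + of_real (of_int n * t)))"
  proof (rule finite_sum_le_infsum[OF sum])
    show "0 \<le> half_plane_weight (w + of_real (of_int n * t))" for n
      using w by (intro less_imp_le half_plane_weight_pos) auto
  qed (auto simp: J_def)
  finally show ?thesis .
qed

lemma dilation_orbits_summable:
  fixes \<alpha> :: real and w :: "'a \<Rightarrow> complex"
  assumes "\<alpha> > 1" and w: "\<And>k. k \<in> K \<Longrightarrow> Im (w k) > 0 \<and> 1 \<le> cmod (w k) \<and> cmod (w k) < \<alpha>"
    and "(\<lambda>k. half_plane_weight (w k)) summable_on K"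
  shows "(\<lambda>(k, n). half_plane_weight (of_real (\<alpha> powi n) * w k)) summable_on K \<times> (UNIV :: int set)"
proof (rule summable_on_comparison_test)
  have "(\<lambda>k. (1 + \<alpha>\<^sup>2) * half_plane_weight (w k)) summable_on K"
    by (intro summable_on_cmult_right assms)
  moreover have "(\<lambda>n::int. (1 / \<alpha>) ^ nat \<bar>n\<bar>) summable_on UNIV"
    using assms(1) by (intro summable_on_int_even summable_geometric) auto
  ultimately show "(\<lambda>(k, n). (1 + \<alpha>\<^sup>2) * half_plane_weight (w k) * (1 / \<alpha>) ^ nat \<bar>n\<bar>)
      summable_on K \<times> (UNIV :: int set)"
    by (rule summable_on_times_nonneg)
      (use assms w in \<open>auto intro!: mult_nonneg_nonneg less_imp_le[OF half_plane_weight_pos]\<close>)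
next
  fix x :: "'a \<times> int" assume "x \<in> K \<times> UNIV"
  then obtain k n where x: "x = (k, n)" "k \<in> K" by auto
  show "(case x of (k, n) \<Rightarrow> half_plane_weight (of_real (\<alpha> powi n) * w k))
      \<le> (case x of (k, n) \<Rightarrow> (1 + \<alpha>\<^sup>2) * half_plane_weight (w k) * (1 / \<alpha>) ^ nat \<bar>n\<bar>)"
    unfolding x prod.case using assms(1) w[OF x(2)] by (intro half_plane_weight_dilation_le) auto
  have "Im (of_real (\<alpha> powi n) * w k) = \<alpha> powi n * Im (w k)"
    by (simp del: of_real_power_int)
  also have "\<dots> > 0"
    using assms(1) w[OF x(2)] by (intro mult_pos_pos zero_less_power_int) auto
  finally show "0 \<le> (case x of (k, n) \<Rightarrow> half_plane_weight (of_real (\<alpha> powi n) * w k))"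
    unfolding x prod.case by (intro less_imp_le half_plane_weight_pos)
qed

text \<open>If the double series converges, the contributions of the orbits tend to 0, so all but finitely
  many orbits are low by the preceding lower bound.\<close>

lemma translation_orbits_summable_iff:
  fixes t :: real and w :: "nat \<Rightarrow> complex"
  assumes t: "t \<noteq> 0" and w: "\<And>k. k \<ge> 1 \<Longrightarrow> Im (w k) > 0 \<and> 0 \<le> Re (w k) \<and> Re (w k) < \<bar>t\<bar>"
    and sum: "(\<lambda>k. half_plane_weight (w k)) summable_on {1..}"
  shows "(\<lambda>(k, n). half_plane_weight (w k + of_real (of_int n * t))) summable_on {1..} \<times> (UNIV :: int set)
    \<longleftrightarrow> (\<exists>M. \<forall>k\<ge>1. Im (w k) \<le> M)"
proof
  assume "\<exists>M. \<forall>k\<ge>1. Im (w k) \<le> M"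
  then obtain M where M: "\<And>k. k \<ge> 1 \<Longrightarrow> Im (w k) \<le> M" by blast
  show "(\<lambda>(k, n). half_plane_weight (w k + of_real (of_int n * t))) summable_on {1..} \<times> (UNIV :: int set)"
  proof (rule summable_on_comparison_test)
    have "(\<lambda>k. (1 + t\<^sup>2 + M\<^sup>2) * half_plane_weight (w k)) summable_on {1..}"
      by (intro summable_on_cmult_right sum)
    moreover have "(\<lambda>n::int. (3 + 2 / t\<^sup>2) * (1 / (1 + (of_int n)\<^sup>2))) summable_on UNIV"
    proof (rule summable_on_cmult_right)
      have "summable (\<lambda>n. 1 / (1 + (real n)\<^sup>2))"
      proof (rule summable_comparison_test')
        show "summable (\<lambda>n. inverse ((real n)\<^sup>2))" by (rule inverse_power_summable) simp
        show "norm (1 / (1 + (real n)\<^sup>2)) \<le> inverse ((real n)\<^sup>2)" if "n \<ge> 1" for n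
          using that by (auto simp: inverse_eq_divide add_nonneg_nonneg
              intro!: divide_left_mono mult_pos_pos add_pos_nonneg)
      qed
      then have "(\<lambda>n::int. 1 / (1 + (real (nat \<bar>n\<bar>))\<^sup>2)) summable_on UNIV"
        by (rule summable_on_int_even) auto
      then show "(\<lambda>n::int. 1 / (1 + (real_of_int n)\<^sup>2)) summable_on UNIV" by simp
    qed
    ultimately show "(\<lambda>(k, n). (1 + t\<^sup>2 + M\<^sup>2) * half_plane_weight (w k) * ((3 + 2 / t\<^sup>2) * (1 / (1 + (of_int n)\<^sup>2))))
        summable_on {1..} \<times> (UNIV :: int set)"
      by (rule summable_on_times_nonneg)
        (use w in \<open>auto intro!: mult_nonneg_nonneg less_imp_le[OF half_plane_weight_pos]\<close>)
    fix x :: "nat \<times> int" assume "x \<in> {1..} \<times> UNIV"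
    then obtain k n where x: "x = (k, n)" "k \<ge> 1" by auto
    show "(case x of (k, n) \<Rightarrow> half_plane_weight (w k + of_real (of_int n * t)))
      \<le> (case x of (k, n) \<Rightarrow> (1 + t\<^sup>2 + M\<^sup>2) * half_plane_weight (w k) * ((3 + 2 / t\<^sup>2) * (1 / (1 + (of_int n)\<^sup>2))))"
      unfolding x prod.case using t w[OF x(2)] M[OF x(2)] by (intro half_plane_weight_translation_le) auto
    show "0 \<le> (case x of (k, n) \<Rightarrow> half_plane_weight (w k + of_real (of_int n * t)))"
      unfolding x prod.case using w[OF x(2)] by (intro less_imp_le half_plane_weight_pos) auto
  qed
next
  assume S: "(\<lambda>(k, n). half_plane_weight (w k + of_real (of_int n * t))) summable_on {1..} \<times> (UNIV :: int set)"
  define s where "s k = (\<Sum>\<^sub>\<infinity>n::int. half_plane_weight (w k + of_real (of_int n * t)))" for k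
  have inner: "(\<lambda>n::int. half_plane_weight (w k + of_real (of_int n * t))) summable_on UNIV" if "k \<ge> 1" for k
    using summable_on_SigmaD1[OF S, of k] that by simp
  have "s summable_on {1..}"
    using summable_on_Sigma_banach[of "\<lambda>k n. half_plane_weight (w k + of_real (of_int n * t))"] S
    by (simp add: s_def[abs_def])
  moreover have "range Suc = {1..}" by (auto simp: image_iff Suc_le_eq gr0_conv_Suc)
  ultimately have "(s \<circ> Suc) summable_on UNIV"
    by (subst summable_on_reindex[symmetric]) auto
  then have "(\<lambda>k. s (Suc k)) \<longlonglongrightarrow> 0"
    by (intro summable_LIMSEQ_zero summable_on_imp_summable) (simp add: o_def)
  then have "\<forall>\<^sub>F k in sequentially. s (Suc k) < 1 / (6 * \<bar>t\<bar>)"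
    using t by (intro order_tendstoD(2)) auto
  then obtain k0 where k0: "\<And>k. k \<ge> k0 \<Longrightarrow> s (Suc k) < 1 / (6 * \<bar>t\<bar>)"
    by (auto simp: eventually_sequentially)
  define M where "M = Max (insert (1 + \<bar>t\<bar>) ((\<lambda>k. Im (w k)) ` {..k0}))"
  have "Im (w k) \<le> M" if k: "k \<ge> 1" for k
  proof (cases "k \<le> k0")
    case True
    then show ?thesis unfolding M_def by (intro Max_ge) auto
  next
    case False
    then obtain j where j: "k = Suc j" "j \<ge> k0" by (cases k) auto
    have "Im (w k) \<le> 1 + \<bar>t\<bar>"
    proof (rule ccontr)
      assume "\<not> Im (w k) \<le> 1 + \<bar>t\<bar>"
      then have "1 / (6 * \<bar>t\<bar>) \<le> s k"
        unfolding s_def using w[OF k] by (intro translation_orbit_weight_ge t inner k) auto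
      with k0[OF j(2)] j(1) show False by simp
    qed
    also have "\<dots> \<le> M" unfolding M_def by (intro Max_ge) auto
    finally show ?thesis .
  qed
  then show "\<exists>M. \<forall>k\<ge>1. Im (w k) \<le> M" by blast
qed

section \<open>Orbits of Blaschke sequences\<close>

theorem theorem3p1:
  fixes \<phi> :: "complex \<Rightarrow> complex" and D :: "complex set" and z :: "nat \<Rightarrow> complex"
  assumes "non_elliptic_automorphism \<phi>"
    and "fundamental_domain \<phi> D"
    and "blaschke_sequence {1..} z"
    and "\<forall>k\<ge>1. z k \<in> D"
  shows "(hyperbolic_automorphism \<phi> \<longrightarrow>
           blaschke_sequence ({1..} \<times> (UNIV :: int set)) (\<lambda>(k, n). disc_iterate \<phi> n (z k))) \<and>
         (parabolic_automorphism \<phi> \<longrightarrow>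
           (\<forall>\<xi> \<in> disc_fixed_points \<phi>.
             blaschke_sequence ({1..} \<times> (UNIV :: int set)) (\<lambda>(k, n). disc_iterate \<phi> n (z k))
             \<longleftrightarrow> (\<exists>c r. horocycle_at \<xi> c r \<and> (\<forall>k\<ge>1. z k \<notin> ball c r))))"
proof -
  let ?I = "{1..} \<times> (UNIV :: int set)"
  let ?orbits = "\<lambda>(k, n). disc_iterate \<phi> n (z k)"
  have z: "z k \<in> unit_disc" if "k \<ge> 1" for k
    using assms(3) that by (simp add: blaschke_sequence_def)
  have \<phi>: "disc_automorphism \<phi>"
    using assms(1)
    by (auto simp: non_elliptic_automorphism_def hyperbolic_automorphism_def parabolic_automorphism_def)
  have exclusive: "\<not> (hyperbolic_automorphism \<phi> \<and> parabolic_automorphism \<phi>)"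
    by (auto simp: hyperbolic_automorphism_def parabolic_automorphism_def)
  have orbits_iff: "blaschke_sequence ?I ?orbits \<longleftrightarrow> (\<lambda>(k, n). half_plane_weight (F n (h (z k)))) summable_on ?I"
    if h: "conformal_map h unit_disc upper_half_plane"
      and conj: "\<forall>w\<in>upper_half_plane. h (\<phi> (inv_into unit_disc h w)) = F 1 w"
      and F: "\<And>w. F 0 w = w" "\<And>m n w. F (m + n) w = F m (F n w)"
    for h and F :: "int \<Rightarrow> complex \<Rightarrow> complex"
  proof -
    have lin: "h (\<phi> u) = F 1 (h u)" if "u \<in> unit_disc" for u
      by (rule conjugated_map[OF h, where F = "F 1", OF _ that]) (use conj in blast)
    have it: "disc_iterate \<phi> n (z k) \<in> unit_disc \<and> h (disc_iterate \<phi> n (z k)) = F n (h (z k))"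
      if "k \<ge> 1" for k n
      by (rule disc_iterate_linearized[where F = F and h = h, OF \<phi> lin F z[OF that]])
    have "blaschke_sequence ?I ?orbits \<longleftrightarrow> (\<lambda>i. half_plane_weight (h (?orbits i))) summable_on ?I"
      by (rule blaschke_sequence_iff_half_plane[OF h]) (use it in auto)
    also have "\<dots> \<longleftrightarrow> (\<lambda>(k, n). half_plane_weight (F n (h (z k)))) summable_on ?I"
      by (rule summable_on_cong) (use it in auto)
    finally show ?thesis .
  qed
  have z_sum: "(\<lambda>k. half_plane_weight (h (z k))) summable_on {1..}"
    if "conformal_map h unit_disc upper_half_plane" for h
    using blaschke_sequence_iff_half_plane[OF that, of "{1..}" z] z assms(3) by auto
  have Im_pos: "Im (h (z k)) > 0" if "conformal_map h unit_disc upper_half_plane" "k \<ge> 1" for h k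
    using that z[OF that(2)] by (auto simp: conformal_map_def upper_half_plane_def bij_betw_def)

  have hyperbolic: "blaschke_sequence ?I ?orbits" if hyp: "hyperbolic_automorphism \<phi>"
  proof -
    obtain h and \<alpha> :: real where h: "conformal_map h unit_disc upper_half_plane" and \<alpha>: "\<alpha> > 1"
      and conj: "\<forall>w\<in>upper_half_plane. h (\<phi> (inv_into unit_disc h w)) = of_real \<alpha> * w"
      and D: "D = {z \<in> unit_disc. 1 \<le> cmod (h z) \<and> cmod (h z) < \<alpha>}"
      using assms(2) hyp exclusive unfolding fundamental_domain_def by blast
    have "blaschke_sequence ?I ?orbits
        \<longleftrightarrow> (\<lambda>(k, n). half_plane_weight (of_real (\<alpha> powi n) * h (z k))) summable_on ?I"
      by (rule orbits_iff[OF h, of "\<lambda>n w. of_real (\<alpha> powi n) * w"])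
        (use \<alpha> conj in \<open>auto simp: power_int_add\<close>)
    moreover have "(\<lambda>(k, n). half_plane_weight (of_real (\<alpha> powi n) * h (z k))) summable_on ?I"
      by (rule dilation_orbits_summable[OF \<alpha> _ z_sum[OF h]]) (use assms(4) D Im_pos[OF h] in auto)
    ultimately show ?thesis by simp
  qed

  have parabolic: "blaschke_sequence ?I ?orbits \<longleftrightarrow> (\<exists>c r. horocycle_at \<xi> c r \<and> (\<forall>k\<ge>1. z k \<notin> ball c r))"
    if par: "parabolic_automorphism \<phi>" and fp: "\<xi> \<in> disc_fixed_points \<phi>" for \<xi>
  proof -
    obtain h and t :: real where h: "conformal_map h unit_disc upper_half_plane" and t: "t \<noteq> 0"
      and conj: "\<forall>w\<in>upper_half_plane. h (\<phi> (inv_into unit_disc h w)) = w + of_real t"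
      and D: "D = {z \<in> unit_disc. 0 \<le> Re (h z) \<and> Re (h z) < \<bar>t\<bar>}"
      using assms(2) par exclusive unfolding fundamental_domain_def by blast
    obtain \<eta> p where \<eta>: "cmod \<eta> = 1" and p: "Im p > 0"
      and form: "\<And>z. z \<in> unit_disc \<Longrightarrow> h z = (\<eta> * p - cnj p * z) / (\<eta> - z)"
      using conformal_map_half_plane_form[OF h] by blast
    have "cmod \<xi> = 1" using par fp by (auto simp: parabolic_automorphism_def)
    moreover from this have "(\<phi> \<longlongrightarrow> \<xi>) (at \<xi> within unit_disc)"
      using fp by (auto simp: disc_fixed_points_def)
    moreover have "h (\<phi> u) = h u + of_real t" if "u \<in> unit_disc" for u
      by (rule conjugated_map[OF h, where F = "\<lambda>w. w + of_real t", OF _ that]) (use conj in blast)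
    ultimately have \<xi>: "\<xi> = \<eta>"
      by (intro parabolic_fixed_point_is_pole[OF \<phi> \<eta> t form])
    have "blaschke_sequence ?I ?orbits
        \<longleftrightarrow> (\<lambda>(k, n). half_plane_weight (h (z k) + of_real (of_int n * t))) summable_on ?I"
      by (rule orbits_iff[OF h, of "\<lambda>n w. w + of_real (of_int n * t)"])
        (use conj in \<open>auto simp: algebra_simps\<close>)
    also have "\<dots> \<longleftrightarrow> (\<exists>M. \<forall>k\<ge>1. Im (h (z k)) \<le> M)"
      by (rule translation_orbits_summable_iff[OF t _ z_sum[OF h]]) (use assms(4) D Im_pos[OF h] in auto)
    also have "\<dots> \<longleftrightarrow> (\<exists>M. \<forall>x\<in>z ` {1..}. Im (h x) \<le> M)" by auto
    also have "\<dots> \<longleftrightarrow> (\<exists>c r. horocycle_at \<eta> c r \<and> z ` {1..} \<inter> ball c r = {})"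
      using z by (intro avoids_horodisc_iff_Im_bounded[OF \<eta> p form, symmetric]) auto
    also have "\<dots> \<longleftrightarrow> (\<exists>c r. horocycle_at \<xi> c r \<and> (\<forall>k\<ge>1. z k \<notin> ball c r))"
      unfolding \<xi> disjoint_iff by (intro ex_cong1 conj_cong refl) blast
    finally show ?thesis .
  qed
  from hyperbolic parabolic show ?thesis by blast
qed

end
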